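(* Let $A\in\mathbb{R}^{m\times n}$ with columns $a_1,\dots,a_n$, and $b\in\mathbb{R}^m$, $u\in\mathbb{R}^n$. For a cost vector $c$ consider the primal $\min\{c^\top x: Ax=b,\ 0\le x\le u\}$ and dual $\max\{y^\top b-u^\top t: A^\top y+s-t=c,\ s,t\ge0\}$. Let $(x',y')$ be optimal primal and dual solutions for costs $c'$, and $(x'',y'')$ optimal primal and dual solutions for costs $c''$ (same $b,u$). Let $R_0=\{i\in[n]:\ a_i^\top y'<c'_i-(\kappa_A+1)\|c'-c''\|_1\}$ and $R_u=\{i\in[n]:\ a_i^\top y'>c'_i+(\kappa_A+1)\|c'-c''\|_1\}$. Then $x''_i=0$ for every $i\in R_0$ and $x''_i=u_i$ for every $i\in R_u$.
   Context: A vector $y\in\mathbb{R}^m$ is called a dual (optimal) solution when it together with $s_i=(c_i-a_i^\top y)^+$, $t_i=(a_i^\top y-c_i)^+$ is (optimal) for the dual. An elementary vector of $\ker(A)$ is a nonzero $g\in\ker(A)$ with inclusion-minimal support among nonzero vectors of $\ker(A)$; $\kappa_A=\max\{|g_j/g_i|: g\text{ elementary},\ i,j\in\mathrm{supp}(g)\}$ for nontrivial $\ker(A)$, and $\kappa_A=1$ if $\ker(A)\in\{\{0\},\mathbb{R}^n\}$. *)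

theory Defs
  imports "HOL-Analysis.Analysis"
begin

text \<open>A real matrix with \<open>m\<close> rows and \<open>n\<close> columns has type \<^typ>\<open>real ^ 'n ^ 'm\<close>;
  \<open>\<le>\<close> on vectors is the componentwise order.\<close>

definition ker :: "real ^ 'n ^ 'm \<Rightarrow> (real ^ 'n) set" where
  "ker A = {x. A *v x = 0}"

definition supp :: "real ^ 'n \<Rightarrow> 'n set" where
  "supp g = {i. g $ i \<noteq> 0}"

definition elementary :: "real ^ 'n ^ 'm \<Rightarrow> real ^ 'n \<Rightarrow> bool" where
  "elementary A g \<longleftrightarrow> g \<in> ker A \<and> g \<noteq> 0 \<and>
     (\<forall>h \<in> ker A. h \<noteq> 0 \<longrightarrow> \<not> supp h \<subset> supp g)"

definition ratios :: "real ^ 'n ^ 'm \<Rightarrow> real set" where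
  "ratios A = {\<bar>g $ j / g $ i\<bar> | g i j. elementary A g \<and> i \<in> supp g \<and> j \<in> supp g}"

text \<open>The maximum is attained: see \<open>finite_ratios\<close> and \<open>ratios_nonempty\<close> below.\<close>

definition kappa :: "real ^ 'n ^ 'm \<Rightarrow> real" where
  "kappa A = (if ker A = {0} \<or> ker A = UNIV then 1 else Max (ratios A))"

definition norm1 :: "real ^ 'n \<Rightarrow> real" where
  "norm1 x = (\<Sum>i\<in>UNIV. \<bar>x $ i\<bar>)"

definition primal_feasible :: "real ^ 'n ^ 'm \<Rightarrow> real ^ 'm \<Rightarrow> real ^ 'n \<Rightarrow> (real ^ 'n) set" where
  "primal_feasible A b u = {x. A *v x = b \<and> 0 \<le> x \<and> x \<le> u}"

definition primal_optimal ::
    "real ^ 'n ^ 'm \<Rightarrow> real ^ 'm \<Rightarrow> real ^ 'n \<Rightarrow> real ^ 'n \<Rightarrow> real ^ 'n \<Rightarrow> bool" where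
  "primal_optimal A b u c x \<longleftrightarrow>
     is_arg_min (\<lambda>x. c \<bullet> x) (\<lambda>x. x \<in> primal_feasible A b u) x"

definition dual_feasible ::
    "real ^ 'n ^ 'm \<Rightarrow> real ^ 'n \<Rightarrow> ((real ^ 'm) \<times> (real ^ 'n) \<times> (real ^ 'n)) set" where
  "dual_feasible A c = {(y, s, t). transpose A *v y + s - t = c \<and> 0 \<le> s \<and> 0 \<le> t}"

text \<open>A vector \<open>y\<close> alone is an optimal dual solution when it is optimal together with
  the slacks \<open>s\<^sub>i = (c\<^sub>i - a\<^sub>i\<^sup>T y)\<^sup>+\<close> and \<open>t\<^sub>i = (a\<^sub>i\<^sup>T y - c\<^sub>i)\<^sup>+\<close>.\<close>

definition dual_optimal ::
    "real ^ 'n ^ 'm \<Rightarrow> real ^ 'm \<Rightarrow> real ^ 'n \<Rightarrow> real ^ 'n \<Rightarrow> real ^ 'm \<Rightarrow> bool" where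
  "dual_optimal A b u c y \<longleftrightarrow>
     is_arg_max (\<lambda>(y, s, t). y \<bullet> b - u \<bullet> t) (\<lambda>z. z \<in> dual_feasible A c)
       (y, (\<chi> i. max 0 (c $ i - column i A \<bullet> y)), (\<chi> i. max 0 (column i A \<bullet> y - c $ i)))"

lemma ratios_nonempty:
  fixes A :: "real ^ 'n ^ 'm"
  assumes "ker A \<noteq> {0}"
  shows "ratios A \<noteq> {}"
proof -
  have "0 \<in> ker A" by (simp add: ker_def)
  with assms obtain h where h: "h \<in> ker A \<and> h \<noteq> 0" by blast
  define g where "g = arg_min (\<lambda>g. card (supp g)) (\<lambda>g. g \<in> ker A \<and> g \<noteq> 0)"
  have g: "g \<in> ker A \<and> g \<noteq> 0"
    unfolding g_def by (rule arg_min_natI[of "\<lambda>g. g \<in> ker A \<and> g \<noteq> 0", OF h])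
  have min: "card (supp g) \<le> card (supp k)" if "k \<in> ker A" "k \<noteq> 0" for k
    unfolding g_def using that by (intro arg_min_nat_le) auto
  have "\<not> supp k \<subset> supp g" if "k \<in> ker A" "k \<noteq> 0" for k
    using min[OF that] psubset_card_mono[of "supp g" "supp k"] by auto
  with g have "elementary A g" by (simp add: elementary_def)
  moreover obtain i where "i \<in> supp g" using g by (auto simp: supp_def vec_eq_iff)
  ultimately show ?thesis by (auto simp: ratios_def)
qed

lemma elementary_supp_unique:
  fixes A :: "real ^ 'n ^ 'm"
  assumes g: "elementary A g" and h: "elementary A h" and eq: "supp g = supp h"
    and i: "i \<in> supp g"
  shows "g $ j / g $ i = h $ j / h $ i"
proof -
  have nz: "g $ i \<noteq> 0" "h $ i \<noteq> 0" using i eq by (auto simp: supp_def)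
  define d where "d = h $ i *s g - g $ i *s h"
  have "d \<in> ker A"
    using g h by (simp add: d_def elementary_def ker_def matrix_vector_mult_diff_distrib vector_scalar_commute)
  moreover have "supp d \<subset> supp g"
  proof
    show "supp d \<subseteq> supp g"
    proof
      fix k assume "k \<in> supp d"
      hence "g $ k \<noteq> 0 \<or> h $ k \<noteq> 0" by (auto simp: d_def supp_def)
      hence "k \<in> supp g \<or> k \<in> supp h" by (simp add: supp_def)
      thus "k \<in> supp g" using eq by blast
    qed
    have "i \<notin> supp d" by (simp add: d_def supp_def)
    thus "supp d \<noteq> supp g" using i by blast
  qed
  ultimately have "d = 0" using g by (auto simp: elementary_def)
  hence "h $ i * g $ j - g $ i * h $ j = 0"
    by (simp add: d_def vec_eq_iff)
  hence "h $ i * g $ j = g $ i * h $ j" by simp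
  thus ?thesis using nz by (simp add: frac_eq_eq mult.commute)
qed

lemma finite_ratios:
  fixes A :: "real ^ 'n ^ 'm"
  shows "finite (ratios A)"
proof -
  define r where "r = (\<lambda>(S, i, j). let g = (SOME g. elementary A g \<and> supp g = S) in \<bar>g $ j / g $ i\<bar>)"
  have "ratios A \<subseteq> r ` UNIV"
  proof
    fix q assume "q \<in> ratios A"
    then obtain g i j where q: "q = \<bar>g $ j / g $ i\<bar>" "elementary A g" "i \<in> supp g"
      by (auto simp: ratios_def)
    define h where "h = (SOME h. elementary A h \<and> supp h = supp g)"
    have "elementary A h \<and> supp h = supp g"
      unfolding h_def by (rule someI[of _ g]) (use q in simp)
    hence "q = r (supp g, i, j)"
      using elementary_supp_unique[of A g h i j] q by (simp add: r_def flip: h_def)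
    thus "q \<in> r ` UNIV" by blast
  qed
  thus ?thesis by (rule finite_subset) simp
qed

end

theory Submission
  imports Defs
begin

text \<open>Optimality of \<open>y'\<close> alone provides a primal point \<open>z\<close> complementary to it: otherwise
  \<open>b\<close> can be separated from the compact convex image under \<open>A\<close> of the face of the box
  \<open>[0, u]\<close> selected by the signs of the reduced costs \<open>c' - A\<^sup>T y'\<close>, and the separating
  direction is one of ascent for the dual. If \<open>x''\<^sub>i \<noteq> z\<^sub>i\<close>, there is an elementary vector \<open>g\<close>
  conformal to \<open>x'' - z \<in> ker A\<close> with \<open>g\<^sub>i \<noteq> 0\<close>. Optimality of \<open>x''\<close> gives \<open>c'' \<bullet> g \<le> 0\<close>.
  By complementarity no reduced cost of \<open>c'\<close> contributes negatively to
  \<open>c' \<bullet> g = (c' - A\<^sup>T y') \<bullet> g\<close>, so the hypothesis on \<open>i\<close> makes \<open>c' \<bullet> g\<close> exceed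
  \<open>\<kappa> * norm1 (c' - c'') * \<bar>g\<^sub>i\<bar> \<ge> (c' - c'') \<bullet> g\<close>, a contradiction.\<close>

section \<open>Conformal decomposition: elementary vectors inside the kernel\<close>

definition conformal :: "real ^ 'n \<Rightarrow> real ^ 'n \<Rightarrow> bool" where
  "conformal g d \<longleftrightarrow> (\<forall>j. g $ j \<noteq> 0 \<longrightarrow> g $ j * d $ j > 0)"

lemma conformal_refl: "conformal d d"
  by (auto simp: conformal_def simp flip: power2_eq_square)

lemma conformal_trans: "conformal f g \<Longrightarrow> conformal g d \<Longrightarrow> conformal f d"
  unfolding conformal_def by (metis mult_eq_0_iff less_irrefl zero_less_mult_iff not_less_iff_gr_or_eq)

text \<open>A ratio test: \<open>t\<close> is the least \<open>g $ j / h $ j\<close> over the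
  coordinates where \<open>h\<close> and \<open>g\<close> agree in sign. Subtracting
  \<open>t *s h\<close> shrinks those coordinates without crossing zero and cancels one attaining
  the minimum; elsewhere on the support of \<open>g\<close> it cannot reduce absolute
  values.\<close>

lemma conformal_reduction:
  fixes g h :: "real ^ 'n"
  assumes sub: "supp h \<subseteq> supp g" and pos: "h $ k * g $ k > 0"
  obtains t where "t > 0" "conformal (g - t *s h) g" "supp (g - t *s h) \<subset> supp g"
proof -
  define P where "P = {j. h $ j * g $ j > 0}"
  define t where "t = Min ((\<lambda>j. g $ j / h $ j) ` P)"
  have "P \<noteq> {}" using pos by (auto simp: P_def)
  then have "t \<in> (\<lambda>j. g $ j / h $ j) ` P" unfolding t_def by (intro Min_in) auto
  then obtain l where l: "l \<in> P" "t = g $ l / h $ l" by auto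
  have tle: "t \<le> g $ j / h $ j" if "j \<in> P" for j
    unfolding t_def using that by (intro Min_le) auto
  have t: "t > 0"
    using l by (auto simp: P_def zero_less_mult_iff zero_less_divide_iff)
  have conf: "conformal (g - t *s h) g"
    unfolding conformal_def
  proof (intro allI impI)
    fix j assume nz: "(g - t *s h) $ j \<noteq> 0"
    then have gj: "g $ j \<noteq> 0" using sub by (auto simp: supp_def subset_iff)
    have "(g $ j - t * h $ j) * g $ j \<ge> 0"
    proof (cases "h $ j * g $ j > 0")
      case True
      then have "t \<le> g $ j / h $ j" using tle by (simp add: P_def)
      then show ?thesis using True
        by (auto simp: zero_less_mult_iff pos_le_divide_eq neg_le_divide_eq
            intro: mult_nonneg_nonneg mult_nonpos_nonpos)
    next
      case False
      then have "t * (h $ j * g $ j) \<le> 0" using t by (simp add: mult_nonneg_nonpos)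
      moreover have "0 \<le> g $ j * g $ j" by simp
      moreover have "(g $ j - t * h $ j) * g $ j = g $ j * g $ j - t * (h $ j * g $ j)"
        by (simp add: algebra_simps)
      ultimately show ?thesis by linarith
    qed
    moreover have "(g $ j - t * h $ j) * g $ j \<noteq> 0" using nz gj by simp
    ultimately have "(g $ j - t * h $ j) * g $ j > 0" by linarith
    then show "(g - t *s h) $ j * g $ j > 0" by simp
  qed
  have "l \<in> supp g" "l \<notin> supp (g - t *s h)" using l by (auto simp: P_def supp_def)
  moreover have "supp (g - t *s h) \<subseteq> supp g"
    using conf by (fastforce simp: conformal_def supp_def)
  ultimately show ?thesis using that t conf by blast
qed

lemma ker_combination:
  "g \<in> ker A \<Longrightarrow> h \<in> ker A \<Longrightarrow> g - t *s h \<in> ker A"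
  by (simp add: ker_def matrix_vector_mult_diff_distrib vector_scalar_commute)

text \<open>Among the kernel vectors conformal to \<open>d\<close> and nonzero at \<open>i\<close>,
  take one of least support size. A nonzero kernel vector of strictly smaller support would allow a
  further reduction that still keeps coordinate \<open>i\<close>.\<close>

lemma exists_conformal_elementary:
  fixes A :: "real ^ 'n ^ 'm"
  assumes "d \<in> ker A" "d $ i \<noteq> 0"
  obtains g where "elementary A g" "conformal g d" "g $ i \<noteq> 0"
proof -
  define Q where "Q = (\<lambda>g. g \<in> ker A \<and> conformal g d \<and> g $ i \<noteq> 0)"
  have "Q d" using assms by (simp add: Q_def conformal_refl)
  then obtain g where g: "Q g" and min: "\<And>f. Q f \<Longrightarrow> card (supp g) \<le> card (supp f)"
    using ex_has_least_nat[of Q d "\<lambda>g. card (supp g)"] by blast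
  have no_red: False if "f \<in> ker A" "conformal f g" "f $ i \<noteq> 0" "supp f \<subset> supp g" for f
  proof -
    have "Q f" using that g by (auto simp: Q_def intro: conformal_trans)
    then show False using min[of f] psubset_card_mono[of "supp g" "supp f"] that by simp
  qed
  \<comment> \<open>Agreement at \<open>k\<close> makes the ratio test applicable, and since
    \<open>h\<close> does not agree with \<open>g\<close> at \<open>i\<close>, the subtraction
    cannot cancel coordinate \<open>i\<close>.\<close>
  have key: False
    if h: "h \<in> ker A" "supp h \<subset> supp g" "h $ i * g $ i \<le> 0" "h $ k * g $ k > 0" for h k
  proof -
    obtain t where t: "t > 0" "conformal (g - t *s h) g" "supp (g - t *s h) \<subset> supp g"
      using conformal_reduction[of h g k] h by blast
    have "(g $ i - t * h $ i) * g $ i = g $ i * g $ i - t * (h $ i * g $ i)"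
      by (simp add: algebra_simps)
    moreover have "t * (h $ i * g $ i) \<le> 0" using t h by (simp add: mult_nonneg_nonpos)
    moreover have "g $ i * g $ i > 0"
      using g by (simp add: Q_def zero_less_mult_iff) linarith
    ultimately have "(g $ i - t * h $ i) * g $ i \<noteq> 0" by linarith
    then have "(g - t *s h) $ i \<noteq> 0" by auto
    moreover have "g - t *s h \<in> ker A" using g h by (simp add: Q_def ker_combination)
    ultimately show False using no_red t by blast
  qed
  have "elementary A g"
    unfolding elementary_def
  proof (intro conjI ballI impI notI)
    show "g \<in> ker A" "g = 0 \<Longrightarrow> False" using g by (auto simp: Q_def)
    fix h assume h: "h \<in> ker A" "h \<noteq> 0" "supp h \<subset> supp g"
    have nh: "- h \<in> ker A" "supp (- h) \<subset> supp g"
      using ker_combination[of 0 A h 1] h by (auto simp: ker_def supp_def)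
    obtain k where k: "h $ k \<noteq> 0" using h by (auto simp: vec_eq_iff)
    then have gk: "h $ k * g $ k \<noteq> 0" using h by (auto simp: supp_def)
    \<comment> \<open>Either \<open>f\<close> is conformal to \<open>g\<close> and thus itself a
      smaller competitor, or it opposes \<open>g\<close> at some \<open>j\<close>; then
      \<open>- f\<close> agrees at \<open>j\<close>, opposes at \<open>i\<close>, and
      \<open>key\<close> applies.\<close>
    have main: False if f: "f \<in> ker A" "supp f \<subset> supp g" "f $ i * g $ i > 0"
        and nf: "- f \<in> ker A" "supp (- f) \<subset> supp g" for f
    proof (cases "conformal f g")
      case True
      moreover have "f $ i \<noteq> 0" using f by auto
      ultimately show False using no_red[of f] f by blast
    next
      case False
      then obtain j where j: "f $ j \<noteq> 0" "f $ j * g $ j \<le> 0"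
        by (auto simp: conformal_def not_less)
      then have "g $ j \<noteq> 0" using f by (auto simp: supp_def)
      with j have "f $ j * g $ j < 0" by (simp add: order_less_le)
      then show False using key[of "- f" j] nf f by simp
    qed
    consider "h $ i * g $ i > 0" | "h $ i * g $ i < 0" | "h $ i * g $ i = 0" by linarith
    then show False
    proof cases
      case 1
      then show ?thesis using main[of h] h nh by simp
    next
      case 2
      then show ?thesis using main[of "- h"] h nh by simp
    next
      \<comment> \<open>Neither \<open>h\<close> nor \<open>- h\<close> touches coordinate
        \<open>i\<close>, and one of them agrees with \<open>g\<close> at \<open>k\<close>.\<close>
      case 3
      then show ?thesis
        using key[of h k] key[of "- h" k] h nh gk by (cases "h $ k * g $ k > 0") auto
    qed
  qed
  then show ?thesis using that g by (auto simp: Q_def)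
qed

section \<open>Bounding the entries of elementary vectors\<close>

lemma elementary_le_kappa:
  fixes A :: "real ^ 'n ^ 'm"
  assumes g: "elementary A g" and i: "g $ i \<noteq> 0"
  shows "\<bar>g $ j\<bar> \<le> kappa A * \<bar>g $ i\<bar>"
proof (cases "ker A = UNIV")
  case True
  \<comment> \<open>The kernel now contains every unit vector, so \<open>g\<close> lives on
    coordinate \<open>i\<close> alone and the default value 1 suffices.\<close>
  have "\<not> supp (axis i 1) \<subset> supp g"
    using g True by (auto simp: elementary_def axis_eq_0_iff)
  moreover have "supp (axis i (1::real)) = {i}" by (auto simp: supp_def axis_def)
  ultimately have "supp g = {i}" using i by (auto simp: supp_def)
  then have "j = i \<or> g $ j = 0" by (auto simp: supp_def)
  then show ?thesis using True by (auto simp: kappa_def)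
next
  case False
  have "ker A \<noteq> {0}" using g by (auto simp: elementary_def)
  then have k: "kappa A = Max (ratios A)" using False by (simp add: kappa_def)
  have le: "\<bar>g $ l / g $ i\<bar> \<le> kappa A" if "g $ l \<noteq> 0" for l
    unfolding k
  proof (rule Max_ge[OF finite_ratios])
    show "\<bar>g $ l / g $ i\<bar> \<in> ratios A" using g i that unfolding ratios_def supp_def by blast
  qed
  show ?thesis
  proof (cases "g $ j = 0")
    case True
    \<comment> \<open>The ratio of \<open>g $ i\<close> to itself gives \<open>kappa A\<close> at
      least 1, so the right-hand side is nonnegative.\<close>
    then show ?thesis using le[of i] i by simp
  next
    case False
    then show ?thesis using le[of j] i by (simp add: abs_divide pos_divide_le_eq)
  qed
qed

section \<open>Step lengths, and a complementary primal point from dual optimality\<close>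

lemma exists_small_scaling:
  fixes w f :: "'n::finite \<Rightarrow> real"
  assumes "\<And>j. w j > 0"
  obtains e where "e > 0" "\<And>j. e * \<bar>f j\<bar> \<le> w j"
proof -
  have "\<forall>\<^sub>F e in at_right 0. e * \<bar>f j\<bar> < w j" for j
  proof (rule order_tendstoD(2))
    show "((\<lambda>e. e * \<bar>f j\<bar>) \<longlongrightarrow> 0) (at_right 0)" by (auto intro!: tendsto_eq_intros)
  qed (rule assms)
  then have "\<forall>\<^sub>F e in at_right 0. \<forall>j. e * \<bar>f j\<bar> < w j" by (rule eventually_all_finite)
  moreover have "\<forall>\<^sub>F e in at_right (0::real). e > 0" by (rule eventually_at_right_less)
  ultimately have "\<forall>\<^sub>F e in at_right 0. e > 0 \<and> (\<forall>j. e * \<bar>f j\<bar> < w j)"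
    by eventually_elim blast
  then obtain e where "e > 0" "\<And>j. e * \<bar>f j\<bar> < w j"
    using eventually_happens'[OF trivial_limit_at_right_real] by blast
  then show ?thesis using that by (meson less_imp_le)
qed

lemma inner_matrix_vector_mult_columns:
  fixes A :: "real ^ 'n ^ 'm"
  shows "y \<bullet> (A *v x) = (\<Sum>j\<in>UNIV. x $ j * (column j A \<bullet> y))"
  by (simp add: matrix_mult_sum inner_sum_right inner_commute scalar_mult_eq_scaleR)

lemma dual_slack_feasible:
  fixes A :: "real ^ 'n ^ 'm"
  shows "(y, (\<chi> i. max 0 (c $ i - column i A \<bullet> y)), (\<chi> i. max 0 (column i A \<bullet> y - c $ i)))
    \<in> dual_feasible A c"
proof -
  have "(transpose A *v y) $ i = column i A \<bullet> y" for i
    by (simp add: matrix_vector_mult_def transpose_def column_def inner_vec_def)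
  then show ?thesis
    by (auto simp: dual_feasible_def vec_eq_iff less_eq_vec_def)
qed

lemma dual_optimal_imp_complementary_primal:
  fixes A :: "real ^ 'n ^ 'm" and c u :: "real ^ 'n" and y b :: "real ^ 'm"
  assumes opt: "dual_optimal A b u c y" and u: "0 \<le> u"
  obtains z where "z \<in> primal_feasible A b u"
    "\<And>i. column i A \<bullet> y < c $ i \<Longrightarrow> z $ i = 0"
    "\<And>i. column i A \<bullet> y > c $ i \<Longrightarrow> z $ i = u $ i"
proof -
  define r where "r i = column i A \<bullet> y - c $ i" for i
  \<comment> \<open>\<open>cbox lo hi\<close> is the face of complementary points. Note that
    \<open>r\<close> is the negated reduced cost; coordinates with \<open>r i = 0\<close> stay
    free.\<close>
  define lo :: "real ^ 'n" where "lo = (\<chi> i. if r i > 0 then u $ i else 0)"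
  define hi :: "real ^ 'n" where "hi = (\<chi> i. if r i < 0 then 0 else u $ i)"
  have u': "0 \<le> u $ i" for i using u by (simp add: less_eq_vec_def)
  have lohi: "lo $ i \<le> hi $ i" for i using u' by (auto simp: lo_def hi_def)
  have "b \<in> (*v) A ` cbox lo hi"
  proof (rule ccontr)
    assume "b \<notin> (*v) A ` cbox lo hi"
    moreover have "convex ((*v) A ` cbox lo hi)"
      by (intro convex_linear_image matrix_vector_mul_linear convex_box)
    moreover have "closed ((*v) A ` cbox lo hi)"
      by (intro compact_imp_closed compact_continuous_image compact_cbox
          linear_continuous_on matrix_vector_mul_bounded_linear)
    ultimately obtain a \<beta> where sep: "a \<bullet> b < \<beta>" "\<forall>x\<in>(*v) A ` cbox lo hi. a \<bullet> x > \<beta>"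
      using separating_hyperplane_closed_point by blast
    define d where "d = - a"
    define q where "q j = column j A \<bullet> d" for j
    \<comment> \<open>The step \<open>e\<close> is so short that no nonzero \<open>r j\<close>
      changes sign; the 1 merely keeps the bound positive where \<open>r j = 0\<close>.\<close>
    have "(if r j = 0 then 1 else \<bar>r j\<bar>) > 0" for j by simp
    then obtain e where e: "e > 0" "\<And>j. e * \<bar>q j\<bar> \<le> (if r j = 0 then 1 else \<bar>r j\<bar>)"
      using exists_small_scaling[of "\<lambda>j. if r j = 0 then 1 else \<bar>r j\<bar>" q] by blast
    \<comment> \<open>The point of the face that maximizes \<open>d \<bullet> (A *v x)\<close>: free
      coordinates go to their upper bound exactly when \<open>q j\<close> is positive.\<close>
    define x :: "real ^ 'n"
      where "x = (\<chi> j. if r j > 0 \<or> r j = 0 \<and> q j > 0 then u $ j else 0)"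
    have "x \<in> cbox lo hi"
      using u' by (auto simp: mem_box_cart x_def lo_def hi_def)
    then have gap: "d \<bullet> (A *v x) < d \<bullet> b" using sep by (fastforce simp: d_def)
    \<comment> \<open>With this \<open>x\<close>, the slack cost is exactly linear over the step,
      with slope \<open>d \<bullet> (A *v x)\<close>. By \<open>gap\<close> this is below the slope
      \<open>d \<bullet> b\<close> of the other term, so the dual objective rises.\<close>
    have pw: "u $ j * max 0 (r j + e * q j) = u $ j * max 0 (r j) + e * (x $ j * q j)" for j
    proof -
      have eq: "\<bar>e * q j\<bar> = e * \<bar>q j\<bar>" using e by (simp add: abs_mult)
      consider "r j > 0" | "r j < 0" | "r j = 0" "q j > 0" | "r j = 0" "q j \<le> 0" by linarith
      then show ?thesis
      proof cases
        case 1
        then have "r j + e * q j \<ge> 0" using e(2)[of j] eq by auto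
        with 1 show ?thesis by (simp add: x_def algebra_simps)
      next
        case 2
        then have "r j + e * q j \<le> 0" using e(2)[of j] eq by auto
        with 2 show ?thesis by (simp add: x_def)
      next
        case 3
        then show ?thesis using e by (simp add: x_def)
      next
        case 4
        then have "e * q j \<le> 0" using e by (simp add: mult_nonneg_nonpos)
        with 4 show ?thesis by (simp add: x_def)
      qed
    qed
    let ?t = "\<lambda>y. (\<chi> j. max 0 (column j A \<bullet> y - c $ j)) :: real ^ 'n"
    have rq: "column j A \<bullet> (y + e *\<^sub>R d) - c $ j = r j + e * q j" for j
      by (simp add: r_def q_def inner_add_right)
    have "u \<bullet> ?t (y + e *\<^sub>R d) = u \<bullet> ?t y + e * (d \<bullet> (A *v x))"
      unfolding inner_matrix_vector_mult_columns
      by (simp add: inner_vec_def[of u] rq pw sum.distrib sum_distrib_left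
          flip: r_def q_def)
    moreover have "(y + e *\<^sub>R d) \<bullet> b = y \<bullet> b + e * (d \<bullet> b)" by (simp add: inner_add_left)
    moreover have "e * (d \<bullet> (A *v x)) < e * (d \<bullet> b)" using gap e by simp
    ultimately have "y \<bullet> b - u \<bullet> ?t y < (y + e *\<^sub>R d) \<bullet> b - u \<bullet> ?t (y + e *\<^sub>R d)" by linarith
    then show False
      using opt dual_slack_feasible[of "y + e *\<^sub>R d" c A]
      by (fastforce simp: dual_optimal_def is_arg_max_def)
  qed
  then obtain z where z: "A *v z = b" "\<And>i. lo $ i \<le> z $ i" "\<And>i. z $ i \<le> hi $ i"
    by (auto simp: mem_box_cart)
  have bds: "0 \<le> lo $ i" "hi $ i \<le> u $ i" for i using u' by (auto simp: lo_def hi_def)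
  show ?thesis
  proof
    show "z \<in> primal_feasible A b u"
      using z(1) order_trans[OF bds(1) z(2)] order_trans[OF z(3) bds(2)]
      by (simp add: primal_feasible_def less_eq_vec_def)
    show "z $ i = 0" if "column i A \<bullet> y < c $ i" for i
      using z(2,3)[of i] that by (auto simp: lo_def hi_def r_def)
    show "z $ i = u $ i" if "column i A \<bullet> y > c $ i" for i
      using z(2,3)[of i] that by (auto simp: lo_def hi_def r_def)
  qed
qed

section \<open>Comparing a primal optimum with the complementary point\<close>

lemma primal_optimal_conformal_nonpos:
  fixes A :: "real ^ 'n ^ 'm"
  assumes opt: "primal_optimal A b u c x" and z: "z \<in> primal_feasible A b u"
    and g: "g \<in> ker A" "conformal g (x - z)"
  shows "c \<bullet> g \<le> 0"
proof -
  have x: "x \<in> primal_feasible A b u"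
    using opt by (simp add: primal_optimal_def is_arg_min_def)
  have gd: "g $ j * (x $ j - z $ j) > 0" if "g $ j \<noteq> 0" for j
    using g that by (simp add: conformal_def)
  have "(if x $ j = z $ j then 1 else \<bar>x $ j - z $ j\<bar>) > 0" for j by simp
  then obtain e where e: "e > 0"
    and le: "\<And>j. e * \<bar>g $ j\<bar> \<le> (if x $ j = z $ j then 1 else \<bar>x $ j - z $ j\<bar>)"
    using exists_small_scaling[of "\<lambda>j. if x $ j = z $ j then 1 else \<bar>x $ j - z $ j\<bar>" "($) g"]
    by blast
  \<comment> \<open>By conformality, subtracting \<open>e *s g\<close> moves each coordinate of
    \<open>x\<close> towards that of \<open>z\<close> without overshooting, so the new point
    inherits the box constraints from both.\<close>
  have bd: "min (x $ j) (z $ j) \<le> (x - e *s g) $ j \<and> (x - e *s g) $ j \<le> max (x $ j) (z $ j)" for j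
  proof (cases "g $ j = 0")
    case False
    then consider "g $ j > 0" "x $ j > z $ j" | "g $ j < 0" "x $ j < z $ j"
      using gd[of j] by (auto simp: zero_less_mult_iff)
    then show ?thesis
    proof cases
      case 1
      moreover have "e * g $ j > 0" using 1 e by simp
      ultimately show ?thesis using le[of j] by auto
    next
      case 2
      moreover have "e * g $ j < 0" using 2 e by (simp add: mult_pos_neg)
      ultimately show ?thesis using le[of j] by auto
    qed
  qed auto
  have "A *v (x - e *s g) = b"
    using x g by (simp add: primal_feasible_def ker_def matrix_vector_mult_diff_distrib
        vector_scalar_commute)
  moreover have "0 \<le> (x - e *s g) $ j" "(x - e *s g) $ j \<le> u $ j" for j
  proof -
    have "0 \<le> x $ j" "0 \<le> z $ j" "x $ j \<le> u $ j" "z $ j \<le> u $ j"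
      using x z by (auto simp: primal_feasible_def less_eq_vec_def)
    then show "0 \<le> (x - e *s g) $ j" "(x - e *s g) $ j \<le> u $ j"
      using bd[of j] by linarith+
  qed
  ultimately have "x - e *s g \<in> primal_feasible A b u"
    by (simp add: primal_feasible_def less_eq_vec_def)
  then have "\<not> c \<bullet> (x - e *s g) < c \<bullet> x"
    using opt by (simp add: primal_optimal_def is_arg_min_def)
  then have "e * (c \<bullet> g) \<le> 0" by (simp add: inner_diff_right scalar_mult_eq_scaleR)
  then show ?thesis using e by (simp add: mult_le_0_iff)
qed

lemma inner_le_norm1:
  fixes f g :: "real ^ 'n"
  assumes "\<And>j. \<bar>g $ j\<bar> \<le> M"
  shows "f \<bullet> g \<le> norm1 f * M"
proof -
  have "f $ j * g $ j \<le> \<bar>f $ j\<bar> * M" for j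
    using mult_left_mono[OF assms[of j], of "\<bar>f $ j\<bar>"] abs_ge_self[of "f $ j * g $ j"]
    by (simp add: abs_mult)
  then show ?thesis by (simp add: inner_vec_def norm1_def sum_distrib_right sum_mono)
qed

lemma optimal_eq_complementary:
  fixes A :: "real ^ 'n ^ 'm" and c' c'' u x z :: "real ^ 'n"
  assumes opt: "primal_optimal A b u c'' x" and z: "z \<in> primal_feasible A b u"
    and z0: "\<And>j. column j A \<bullet> y < c' $ j \<Longrightarrow> z $ j = 0"
    and zu: "\<And>j. column j A \<bullet> y > c' $ j \<Longrightarrow> z $ j = u $ j"
    and big: "\<bar>c' $ i - column i A \<bullet> y\<bar> > kappa A * norm1 (c' - c'')"
  shows "x $ i = z $ i"
proof (rule ccontr)
  assume ne: "x $ i \<noteq> z $ i"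
  have x: "x \<in> primal_feasible A b u"
    using opt by (simp add: primal_optimal_def is_arg_min_def)
  have "x - z \<in> ker A"
    using x z by (simp add: primal_feasible_def ker_def matrix_vector_mult_diff_distrib)
  then obtain g where g: "elementary A g" "conformal g (x - z)" "g $ i \<noteq> 0"
    using exists_conformal_elementary[of "x - z" A i] ne by auto
  then have gker: "g \<in> ker A" by (simp add: elementary_def)
  define r where "r j = c' $ j - column j A \<bullet> y" for j
  \<comment> \<open>If \<open>r j > 0\<close> then \<open>z\<close> is at its lower bound, so
    \<open>x - z\<close>, and with it \<open>g\<close>, can only be positive there; at the upper
    bound the signs are mirrored.\<close>
  have sign: "0 \<le> r j * g $ j" for j
  proof (cases "g $ j = 0")
    case False
    then have gd: "g $ j * (x $ j - z $ j) > 0" using g by (simp add: conformal_def)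
    have bd: "0 \<le> x $ j" "x $ j \<le> u $ j"
      using x by (auto simp: primal_feasible_def less_eq_vec_def)
    consider "r j = 0" | "r j > 0" | "r j < 0" by linarith
    then show ?thesis
    proof cases
      case 2
      then have "z $ j = 0" using z0 by (simp add: r_def)
      then show ?thesis using gd bd 2 by (auto simp: zero_less_mult_iff)
    next
      case 3
      then have "z $ j = u $ j" using zu by (simp add: r_def)
      then show ?thesis using gd bd 3 by (auto simp: zero_less_mult_iff zero_le_mult_iff)
    qed simp
  qed simp
  \<comment> \<open>As \<open>A *v g = 0\<close>, costs may be replaced by reduced costs; all terms
    being nonnegative, the one at \<open>i\<close> is a lower bound.\<close>
  have "c' \<bullet> g = c' \<bullet> g - y \<bullet> (A *v g)" using gker by (simp add: ker_def)
  also have "\<dots> = (\<Sum>j\<in>UNIV. r j * g $ j)"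
    unfolding inner_matrix_vector_mult_columns
    by (simp add: inner_vec_def[of c'] r_def algebra_simps sum_subtractf)
  also have "\<dots> \<ge> r i * g $ i" using sign by (intro member_le_sum) auto
  finally have "\<bar>r i\<bar> * \<bar>g $ i\<bar> \<le> c' \<bullet> g" using sign[of i] by (simp flip: abs_mult)
  moreover have "kappa A * norm1 (c' - c'') * \<bar>g $ i\<bar> < \<bar>r i\<bar> * \<bar>g $ i\<bar>"
    using big g(3) by (simp add: r_def)
  moreover have "(c' - c'') \<bullet> g \<le> norm1 (c' - c'') * (kappa A * \<bar>g $ i\<bar>)"
    using elementary_le_kappa[OF g(1,3)] by (rule inner_le_norm1)
  moreover have "c'' \<bullet> g \<le> 0"
    using primal_optimal_conformal_nonpos[OF opt z gker g(2)] .
  ultimately show False by (simp add: inner_diff_left algebra_simps)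
qed

theorem theorem6p5:
  fixes A :: "real ^ 'n ^ 'm" and b :: "real ^ 'm" and u :: "real ^ 'n"
    and c' c'' x' x'' :: "real ^ 'n" and y' y'' :: "real ^ 'm"
  assumes "primal_optimal A b u c' x'" and "dual_optimal A b u c' y'"
    and "primal_optimal A b u c'' x''" and "dual_optimal A b u c'' y''"
  shows "let R\<^sub>0 = {i. column i A \<bullet> y' < c' $ i - (kappa A + 1) * norm1 (c' - c'')};
             R\<^sub>u = {i. column i A \<bullet> y' > c' $ i + (kappa A + 1) * norm1 (c' - c'')}
         in (\<forall>i \<in> R\<^sub>0. x'' $ i = 0) \<and> (\<forall>i \<in> R\<^sub>u. x'' $ i = u $ i)"
proof -
  have "x'' \<in> primal_feasible A b u"
    using assms(3) by (simp add: primal_optimal_def is_arg_min_def)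
  then have "0 \<le> u" by (auto simp: primal_feasible_def intro: order_trans)
  then obtain z where z: "z \<in> primal_feasible A b u"
    and z0: "\<And>i. column i A \<bullet> y' < c' $ i \<Longrightarrow> z $ i = 0"
    and zu: "\<And>i. column i A \<bullet> y' > c' $ i \<Longrightarrow> z $ i = u $ i"
    using dual_optimal_imp_complementary_primal[OF assms(2)] by blast
  define \<delta> where "\<delta> = norm1 (c' - c'')"
  have \<delta>: "0 \<le> \<delta>" by (simp add: \<delta>_def norm1_def sum_nonneg)
  \<comment> \<open>Nonnegativity makes the margin \<open>(kappa A + 1) * \<delta>\<close> at least
    \<open>kappa A * \<delta>\<close> and at least 0, so it yields both
    \<open>x'' $ i = z $ i\<close> and the side of complementarity that fixes
    \<open>z $ i\<close>.\<close>
  have "0 \<le> kappa A"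
  proof (cases "ker A = {0} \<or> ker A = UNIV")
    case True
    then show ?thesis by (auto simp: kappa_def)
  next
    case False
    then have "kappa A \<in> ratios A"
      using Max_in[OF finite_ratios ratios_nonempty, of A] by (simp add: kappa_def)
    then show ?thesis by (auto simp: ratios_def)
  qed
  then have \<kappa>\<delta>: "0 \<le> kappa A * \<delta>" using \<delta> by simp
  have eq: "x'' $ i = z $ i" if "\<bar>c' $ i - column i A \<bullet> y'\<bar> > kappa A * \<delta>" for i
    using optimal_eq_complementary[OF assms(3) z z0 zu] that by (simp add: \<delta>_def)
  have "x'' $ i = 0" if "column i A \<bullet> y' < c' $ i - (kappa A + 1) * \<delta>" for i
    using eq[of i] z0[of i] that \<delta> \<kappa>\<delta> by (auto simp: distrib_right)
  moreover have "x'' $ i = u $ i" if "column i A \<bullet> y' > c' $ i + (kappa A + 1) * \<delta>" for i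
    using eq[of i] zu[of i] that \<delta> \<kappa>\<delta> by (auto simp: distrib_right)
  ultimately show ?thesis by (auto simp: Let_def \<delta>_def)
qed

end
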